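(* Let $0<R<1$ and consider the random linear code ensemble $\mathcal{R}_{n,(1-R)n}$ with design rate $R$. Let $K_1,K_2$ be positive real constants that do not depend on $n$. If $\Phi_w=K_1^{w}K_2^{n-w}$ for $1\le w\le n$, then the asymptotic concentration rate of $F(H)=\sum_{w=1}^n\Phi_wA_w(H)$ is $$\eta=\log\frac{K_1^2+K_2^2}{(K_1+K_2)^2}+1-R.$$
   Context: The random linear code ensemble $\mathcal{R}_{n,m}$ is the set of all binary $m\times n$ matrices, each with probability $2^{-nm}$; $\mathrm{E}$ and $\mathrm{VAR}$ denote expectation and variance with respect to it. $A_w(H)$ is the number of binary vectors $x\in F_2^n$ of Hamming weight $w$ with $Hx=0$ over $F_2$. Logarithms are base 2. The asymptotic concentration rate (ACR) of $F$ is $$\eta=\lim_{n\to\infty}\frac1n\log\left(\frac{\mathrm{VAR}_{\mathcal{R}_{n,(1-R)n}}[F]}{\mathrm{E}_{\mathcal{R}_{n,(1-R)n}}[F]^2}\right)$$ if the limit exists. The limit in $n$ is over those $n$ for which $(1-R)n$ is an integer. *)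

theory Defs
  imports Complex_Main "HOL-Library.Z2" "HOL-Probability.Probability" "Jordan_Normal_Form.Matrix"
begin

definition hamming_weight :: "bit vec \<Rightarrow> nat" where
  "hamming_weight x = card {i. i < dim_vec x \<and> x $ i \<noteq> 0}"

definition weight_distribution :: "nat \<Rightarrow> bit mat \<Rightarrow> nat" where
  "weight_distribution w H =
     card {x \<in> carrier_vec (dim_col H). hamming_weight x = w \<and> H *\<^sub>v x = 0\<^sub>v (dim_row H)}"

text \<open>The arguments are the number of columns (block length) \<open>n\<close> and the number of rows
  (parity checks) \<open>m\<close>, in this order, as in the usual notation for the ensemble.\<close>

definition random_linear_code :: "nat \<Rightarrow> nat \<Rightarrow> bit mat pmf" where
  "random_linear_code n m = pmf_of_set (carrier_mat m n)"

text \<open>The lengths \<open>n\<close> tending to infinity among those for which \<open>(1 - R) * n\<close> is an integer.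
  This filter is nontrivial exactly if \<open>R\<close> is rational, see
  \<open>design_lengths_neq_bot_iff\<close>; for irrational \<open>R\<close> no positive length is admissible.\<close>

definition design_lengths :: "real \<Rightarrow> nat filter" where
  "design_lengths R = inf sequentially (principal {n. (1 - R) * real n \<in> \<int>})"

text \<open>\<open>F n\<close> is the quantity considered at block length \<open>n\<close>. The floor is exact along
  \<open>design_lengths R\<close>.\<close>

definition has_acr :: "real \<Rightarrow> (nat \<Rightarrow> bit mat \<Rightarrow> real) \<Rightarrow> real \<Rightarrow> bool" where
  "has_acr R F \<eta> \<longleftrightarrow>
     ((\<lambda>n. let M = random_linear_code n (nat \<lfloor>(1 - R) * real n\<rfloor>) in
            1 / real n * log 2 (measure_pmf.variance M (F n) / (measure_pmf.expectation M (F n))\<^sup>2))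
        \<longlongrightarrow> \<eta>) (design_lengths R)"

lemma bij_betw_carrier_mat:
  "bij_betw (\<lambda>f. mat m n f) (({..<m} \<times> {..<n}) \<rightarrow>\<^sub>E UNIV) (carrier_mat m n)"
proof (rule bij_betwI[where g = "\<lambda>A. restrict (\<lambda>ij. A $$ ij) ({..<m} \<times> {..<n})"])
  fix f :: "nat \<times> nat \<Rightarrow> 'a" assume "f \<in> ({..<m} \<times> {..<n}) \<rightarrow>\<^sub>E UNIV"
  then show "restrict (\<lambda>ij. mat m n f $$ ij) ({..<m} \<times> {..<n}) = f"
    by (fastforce simp: restrict_def PiE_def extensional_def)
qed auto

lemma UNIV_bit: "(UNIV :: bit set) = {0, 1}"
  by (auto intro: bit.exhaust)

lemma finite_carrier_bit_mat: "finite (carrier_mat m n :: bit mat set)"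
  using bij_betw_finite[OF bij_betw_carrier_mat[of m n, where ?'a = bit]]
  by (simp add: finite_PiE UNIV_bit)

lemma card_carrier_bit_mat: "card (carrier_mat m n :: bit mat set) = 2 ^ (n * m)"
  using bij_betw_same_card[OF bij_betw_carrier_mat[of m n, where ?'a = bit]]
  by (simp add: card_PiE UNIV_bit power_mult[symmetric] mult.commute flip: numeral_2_eq_2)

lemma pmf_random_linear_code:
  assumes "H \<in> carrier_mat m n"
  shows "pmf (random_linear_code n m) H = 1 / 2 ^ (n * m)"
  using assms finite_carrier_bit_mat[of m n] unfolding random_linear_code_def
  by (subst pmf_of_set) (auto simp: card_carrier_bit_mat)

lemma design_lengths_neq_bot_iff: "design_lengths R \<noteq> bot \<longleftrightarrow> R \<in> \<rat>"
proof
  assume "R \<in> \<rat>"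
  then obtain a :: int and b :: nat where b: "b > 0" and R: "R = of_int a / of_nat b"
    by (metis Rats_cases' of_int_of_nat_eq zero_less_imp_eq_int of_nat_0_less_iff)
  have *: "(1 - R) * real (b * k) \<in> \<int>" for k
  proof -
    have "(1 - R) * real (b * k) = of_int ((int b - a) * int k)"
      using b by (simp add: R field_simps)
    then show ?thesis by (metis Ints_of_int)
  qed
  have "\<exists>n\<ge>N. (1 - R) * real n \<in> \<int>" for N
    using *[of N] b by (intro exI[of _ "b * N"]) auto
  then show "design_lengths R \<noteq> bot"
    unfolding design_lengths_def trivial_limit_def
    by (auto simp: eventually_inf_principal eventually_sequentially)
next
  assume "design_lengths R \<noteq> bot"
  then have "\<exists>n\<ge>1. (1 - R) * real n \<in> \<int>"
    unfolding design_lengths_def trivial_limit_def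
    by (auto simp: eventually_inf_principal eventually_sequentially)
  then obtain n :: nat and z :: int where "n \<ge> 1" "(1 - R) * real n = of_int z"
    by (auto elim: Ints_cases)
  then have "R = 1 - of_int z / of_nat n"
    by (simp add: field_simps)
  then show "R \<in> \<rat>" by simp
qed

end

theory Submission
  imports Defs
begin

text \<open>
  \<open>F\<close> is the weighted sum of the indicators of the events \<open>H x = 0\<close> over the nonzero vectors \<open>x\<close>.
  Distinct nonzero vectors over \<open>F\<^sub>2\<close> are linearly independent, so these events have
  probability \<open>2\<^sup>-\<^sup>m\<close> and are pairwise independent; hence \<open>E = S\<^sub>1 / 2\<^sup>m\<close> and
  \<open>VAR = S\<^sub>2 2\<^sup>-\<^sup>m (1 - 2\<^sup>-\<^sup>m)\<close>, where by the binomial theorem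
  \<open>S\<^sub>1 = (K1 + K2)^n - K2^n\<close> and \<open>S\<^sub>2 = (K1^2 + K2^2)^n - K2^(2 n)\<close>. The subtracted terms are
  exponentially smaller than the leading ones and do not influence the rate.
\<close>

section \<open>Binary vectors, their supports and their weights\<close>

lemma bij_betw_support:
  "bij_betw (\<lambda>x :: bit vec. {i. i < dim_vec x \<and> x $ i \<noteq> 0}) (carrier_vec n) (Pow {..<n})"
proof (rule bij_betwI[where g = "\<lambda>S. vec n (\<lambda>i. of_bool (i \<in> S))"])
  fix x :: "bit vec" assume "x \<in> carrier_vec n"
  then show "vec n (\<lambda>i. of_bool (i \<in> {i. i < dim_vec x \<and> x $ i \<noteq> 0})) = x"
    by (intro eq_vecI) auto
qed auto

lemma finite_carrier_bit_vec: "finite (carrier_vec n :: bit vec set)"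
  using bij_betw_finite[OF bij_betw_support[of n]] by simp

lemma card_carrier_bit_vec: "card (carrier_vec n :: bit vec set) = 2 ^ n"
  using bij_betw_same_card[OF bij_betw_support[of n]] by (simp add: card_Pow)

text \<open>Expand (a + b)^n by choosing the set \<open>S\<close> of coordinates that contribute
  \<open>a\<close>; over F_2 each \<open>S\<close> is the support of exactly one vector.\<close>

lemma sum_hamming_weight:
  fixes a b :: "'a :: comm_semiring_1"
  shows "(\<Sum>x\<in>carrier_vec n. a ^ hamming_weight x * b ^ (n - hamming_weight x)) = (a + b) ^ n"
proof -
  have "(a + b) ^ n = (\<Sum>S\<in>Pow {..<n}. a ^ card S * b ^ (n - card S))"
    using prod_add[of "{..<n}" "\<lambda>_. a" "\<lambda>_. b"]
    by (auto simp: card_Diff_subset finite_subset[of _ "{..<n}"] intro!: sum.cong)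
  also have "\<dots> = (\<Sum>x\<in>carrier_vec n. a ^ hamming_weight x * b ^ (n - hamming_weight x))"
    unfolding hamming_weight_def by (rule sum.reindex_bij_betw[OF bij_betw_support, symmetric])
  finally show ?thesis ..
qed

lemma hamming_weight_eq_0_iff:
  assumes "x \<in> carrier_vec n"
  shows "hamming_weight x = 0 \<longleftrightarrow> x = 0\<^sub>v n"
  using assms unfolding hamming_weight_def by (auto simp: card_eq_0_iff)

lemma hamming_weight_zero_vec [simp]: "hamming_weight (0\<^sub>v n) = 0"
  by (simp add: hamming_weight_eq_0_iff[of _ n])

lemma hamming_weight_le:
  assumes "x \<in> carrier_vec n"
  shows "hamming_weight x \<le> n"
  using assms card_mono[of "{..<n}" "{i. i < dim_vec x \<and> x $ i \<noteq> 0}"]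
  unfolding hamming_weight_def by auto

section \<open>Counting the matrices that annihilate one or two given vectors\<close>

text \<open>Supplies dual vectors for x and y. The case y = 0 is allowed, so the same lemma serves a
  single nonzero vector.\<close>

lemma separating_bit_vec:
  fixes x y :: "bit vec"
  assumes x: "x \<in> carrier_vec n" and y: "y \<in> carrier_vec n" and "x \<noteq> 0\<^sub>v n" "x \<noteq> y"
  obtains a where "a \<in> carrier_vec n" "a \<bullet> x = 1" "a \<bullet> y = 0"
proof (cases "\<exists>i<n. x $ i = 1 \<and> y $ i = 0")
  case True
  then obtain i where "i < n" "x $ i = 1" "y $ i = 0" by blast
  then show ?thesis using x y by (intro that[of "unit_vec n i"]) auto
next
  case False
  \<comment> \<open>Now the support of x lies properly inside that of y. Take i in the support of x
    and j in that of y only: the sum of the two unit vectors gives 1 + 0 on x and 1 + 1 = 0 on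
    y.\<close>
  obtain i where i: "i < n" "x $ i = 1"
    using assms by (metis bit_not_zero_iff eq_vecI carrier_vecD index_zero_vec)
  obtain j where j: "j < n" "x $ j \<noteq> y $ j"
    using assms by (metis eq_vecI carrier_vecD)
  have "y $ i = 1" "x $ j = 0" "y $ j = 1"
    using False i j by (metis bit_not_zero_iff)+
  then show ?thesis using x y i j
    by (intro that[of "unit_vec n i + unit_vec n j"]) (auto simp: add_scalar_prod_distrib[of _ n])
qed

lemma card_eq_card_mult_card_fibre:
  assumes "finite A" "finite B" "f \<in> A \<rightarrow> B"
    and "\<And>b. b \<in> B \<Longrightarrow> bij_betw (\<tau> b) {a \<in> A. f a = c} {a \<in> A. f a = b}"
  shows "card A = card B * card {a \<in> A. f a = c}"
proof -
  have "card A = (\<Sum>b\<in>B. card {a \<in> A. f a = b})"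
    using sum.group[of A B f "\<lambda>_. 1 :: nat"] assms(1-3) by (simp add: image_subset_iff_funcset)
  also have "\<dots> = (\<Sum>b\<in>B. card {a \<in> A. f a = c})"
    using bij_betw_same_card[OF assms(4)] by simp
  finally show ?thesis by simp
qed

text \<open>In characteristic 2 adding \<open>H0\<close> is an involution, so it is its own inverse.
  The predicates stay abstract to cover both one and two parity checks.\<close>

lemma bij_betw_translate_bit_mat:
  fixes H0 :: "bit mat"
  assumes "H0 \<in> carrier_mat m n"
    and "\<And>H. H \<in> carrier_mat m n \<Longrightarrow> P H \<Longrightarrow> Q (H + H0)"
    and "\<And>H. H \<in> carrier_mat m n \<Longrightarrow> Q H \<Longrightarrow> P (H + H0)"
  shows "bij_betw (\<lambda>H. H + H0) {H \<in> carrier_mat m n. P H} {H \<in> carrier_mat m n. Q H}"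
proof -
  have *: "H + H0 + H0 = H" if "H \<in> carrier_mat m n" for H
    using that assms(1) by (intro eq_matI) (auto simp: add.assoc)
  show ?thesis
    using assms by (intro bij_betwI[where g = "\<lambda>H. H + H0"]) (auto simp: *)
qed

lemma outer_mult_vec:
  fixes u a x :: "'a :: comm_semiring_0 vec"
  assumes "u \<in> carrier_vec m" "a \<in> carrier_vec n" "x \<in> carrier_vec n"
  shows "mat m n (\<lambda>(i, j). u $ i * a $ j) *\<^sub>v x = (a \<bullet> x) \<cdot>\<^sub>v u"
  using assms
  by (intro eq_vecI)
    (auto simp: scalar_prod_def sum_distrib_left sum_distrib_right ac_simps intro!: sum.cong)

text \<open>All fibres of the linear maps \<open>H \<mapsto> H x\<close> and \<open>H \<mapsto> (H x, H y)\<close> are translates of the kernel,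
  the translations being sums of outer products with vectors dual to \<open>x\<close> and \<open>y\<close>.\<close>

lemma card_parity_check:
  fixes x :: "bit vec"
  assumes x: "x \<in> carrier_vec n" "x \<noteq> 0\<^sub>v n"
  shows "2 ^ m * card {H \<in> carrier_mat m n. H *\<^sub>v x = 0\<^sub>v m} = 2 ^ (n * m)"
proof -
  obtain a where a: "a \<in> carrier_vec n" "a \<bullet> x = 1"
    using separating_bit_vec[of x n "0\<^sub>v n"] x by auto
  define \<tau> where "\<tau> u = mat m n (\<lambda>(i, j). u $ i * a $ j)" for u
  have \<tau>: "\<tau> u \<in> carrier_mat m n" for u
    by (simp add: \<tau>_def)
  have \<tau>x: "\<tau> u *\<^sub>v x = u" if "u \<in> carrier_vec m" for u
    using outer_mult_vec[OF that a(1) x(1)] a by (simp add: \<tau>_def)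
  have dbl: "u + u = 0\<^sub>v m" if "u \<in> carrier_vec m" for u :: "bit vec"
    using that by (intro eq_vecI) auto
  have "card (carrier_mat m n :: bit mat set) = card (carrier_vec m :: bit vec set)
          * card {H \<in> carrier_mat m n. H *\<^sub>v x = 0\<^sub>v m}"
    using x \<tau> \<tau>x
    by (intro card_eq_card_mult_card_fibre[where \<tau> = "\<lambda>u H. H + \<tau> u"] bij_betw_translate_bit_mat
        finite_carrier_bit_mat finite_carrier_bit_vec) (auto simp: add_mult_distrib_mat_vec[of _ m n] dbl)
  then show ?thesis by (simp add: card_carrier_bit_mat card_carrier_bit_vec)
qed

lemma card_two_parity_checks:
  fixes x y :: "bit vec"
  assumes x: "x \<in> carrier_vec n" "x \<noteq> 0\<^sub>v n" and y: "y \<in> carrier_vec n" "y \<noteq> 0\<^sub>v n"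
    and "x \<noteq> y"
  shows "2 ^ m * 2 ^ m * card {H \<in> carrier_mat m n. H *\<^sub>v x = 0\<^sub>v m \<and> H *\<^sub>v y = 0\<^sub>v m} = 2 ^ (n * m)"
proof -
  obtain a where a: "a \<in> carrier_vec n" "a \<bullet> x = 1" "a \<bullet> y = 0"
    using separating_bit_vec[of x n y] assms by auto
  obtain b where b: "b \<in> carrier_vec n" "b \<bullet> y = 1" "b \<bullet> x = 0"
    using separating_bit_vec[of y n x] assms by auto
  \<comment> \<open>By duality the first outer product sets the value at x to u and vanishes on y;
    the second sets the value at y to v and vanishes on x.\<close>
  define \<tau> where "\<tau> = (\<lambda>(u, v). mat m n (\<lambda>(i, j). u $ i * a $ j) + mat m n (\<lambda>(i, j). v $ i * b $ j))"
  have \<tau>: "\<tau> p \<in> carrier_mat m n" for p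
    by (simp add: \<tau>_def split: prod.splits)
  have \<tau>x: "\<tau> (u, v) *\<^sub>v x = u" and \<tau>y: "\<tau> (u, v) *\<^sub>v y = v"
    if "u \<in> carrier_vec m" "v \<in> carrier_vec m" for u v
    using that outer_mult_vec[OF that(1) a(1) x(1)] outer_mult_vec[OF that(2) b(1) x(1)]
      outer_mult_vec[OF that(1) a(1) y(1)] outer_mult_vec[OF that(2) b(1) y(1)] a b x y
    by (auto simp: \<tau>_def add_mult_distrib_mat_vec[of _ m n] intro!: eq_vecI)
  have dbl: "u + u = 0\<^sub>v m" if "u \<in> carrier_vec m" for u :: "bit vec"
    using that by (intro eq_vecI) auto
  have "card (carrier_mat m n :: bit mat set)
      = card (carrier_vec m \<times> carrier_vec m :: (bit vec \<times> bit vec) set)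
          * card {H \<in> carrier_mat m n. (H *\<^sub>v x, H *\<^sub>v y) = (0\<^sub>v m, 0\<^sub>v m)}"
    using x y \<tau> \<tau>x \<tau>y
    by (intro card_eq_card_mult_card_fibre[where \<tau> = "\<lambda>p H. H + \<tau> p"] bij_betw_translate_bit_mat
        finite_carrier_bit_mat finite_cartesian_product finite_carrier_bit_vec)
      (auto simp: add_mult_distrib_mat_vec[of _ m n] dbl)
  then show ?thesis
    by (simp add: card_carrier_bit_mat card_carrier_bit_vec card_cartesian_product)
qed

section \<open>Mean and variance of weighted sums of codeword indicators\<close>

lemma expectation_random_linear_code:
  fixes f :: "bit mat \<Rightarrow> real"
  shows "measure_pmf.expectation (random_linear_code n m) f
    = (\<Sum>H\<in>carrier_mat m n. f H) / 2 ^ (n * m)"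
proof -
  have "carrier_mat m n \<noteq> ({} :: bit mat set)"
    using zero_carrier_mat by blast
  then show ?thesis
    unfolding random_linear_code_def
    by (simp add: integral_pmf_of_set finite_carrier_bit_mat card_carrier_bit_mat)
qed

context
  fixes n m :: nat and X :: "bit vec set" and c :: "bit vec \<Rightarrow> real" and F :: "bit mat \<Rightarrow> real"
  assumes X: "X \<subseteq> carrier_vec n - {0\<^sub>v n}"
    and F: "\<And>H. H \<in> carrier_mat m n \<Longrightarrow> F H = (\<Sum>x\<in>X. c x * of_bool (H *\<^sub>v x = 0\<^sub>v m))"
begin

lemma expectation_sum_codewords:
  "measure_pmf.expectation (random_linear_code n m) F = (\<Sum>x\<in>X. c x) / 2 ^ m"
proof -
  have "(\<Sum>H\<in>carrier_mat m n. F H)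
      = (\<Sum>x\<in>X. c x * real (card {H \<in> carrier_mat m n. H *\<^sub>v x = 0\<^sub>v m}))"
    by (simp add: F sum.swap[of _ X] finite_carrier_bit_mat Int_def flip: sum_distrib_left)
  also have "\<dots> = (\<Sum>x\<in>X. c x * (2 ^ (n * m) / 2 ^ m))"
  proof (intro sum.cong refl arg_cong2[where f = "(*)"])
    fix x assume "x \<in> X"
    then show "real (card {H \<in> carrier_mat m n. H *\<^sub>v x = 0\<^sub>v m}) = 2 ^ (n * m) / 2 ^ m"
      using X arg_cong[OF card_parity_check[of x n m], of real] by (auto simp: field_simps)
  qed
  finally show ?thesis
    by (simp add: expectation_random_linear_code flip: sum_distrib_right sum_divide_distrib)
qed

text \<open>Pairwise independence makes all covariances of distinct indicators vanish, so only the
  variances q (1 - q) of the single indicators remain, weighted by the squared coefficients.\<close>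

lemma variance_sum_codewords:
  "measure_pmf.variance (random_linear_code n m) F
    = (\<Sum>x\<in>X. (c x)\<^sup>2) * (1 / 2 ^ m) * (1 - 1 / 2 ^ m)"
proof -
  define q :: real where "q = 1 / 2 ^ m"
  have finX: "finite X"
    using X finite_carrier_bit_vec finite_subset by blast
  \<comment> \<open>The joint probability is q^2 off the diagonal and q on it; splitting off q^2
    uniformly turns the double sum into a squared sum plus a diagonal correction.\<close>
  have pair: "real (card {H \<in> carrier_mat m n. H *\<^sub>v x = 0\<^sub>v m \<and> H *\<^sub>v y = 0\<^sub>v m})
      = 2 ^ (n * m) * (q\<^sup>2 + of_bool (x = y) * (q - q\<^sup>2))" if "x \<in> X" "y \<in> X" for x y
    using X that arg_cong[OF card_parity_check[of x n m], of real]
      arg_cong[OF card_two_parity_checks[of x n y m], of real]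
    by (cases "x = y") (auto simp: field_simps q_def power2_eq_square)
  have "(\<Sum>H\<in>carrier_mat m n. (F H)\<^sup>2)
      = (\<Sum>H\<in>carrier_mat m n. \<Sum>x\<in>X. \<Sum>y\<in>X.
           c x * c y * of_bool (H *\<^sub>v x = 0\<^sub>v m \<and> H *\<^sub>v y = 0\<^sub>v m))"
    by (intro sum.cong) (auto simp: F power2_eq_square sum_product intro!: sum.cong)
  also have "\<dots> = (\<Sum>x\<in>X. \<Sum>y\<in>X. \<Sum>H\<in>carrier_mat m n.
           c x * c y * of_bool (H *\<^sub>v x = 0\<^sub>v m \<and> H *\<^sub>v y = 0\<^sub>v m))"
    by (subst sum.swap, intro sum.cong refl, subst sum.swap) simp
  also have "\<dots> = (\<Sum>x\<in>X. \<Sum>y\<in>X. c x * c y *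
           real (card {H \<in> carrier_mat m n. H *\<^sub>v x = 0\<^sub>v m \<and> H *\<^sub>v y = 0\<^sub>v m}))"
    by (simp add: finite_carrier_bit_mat Int_def flip: sum_distrib_left)
  also have "\<dots> = (\<Sum>x\<in>X. \<Sum>y\<in>X. 2 ^ (n * m) * (q\<^sup>2 * (c x * c y))
           + (if x = y then 2 ^ (n * m) * ((q - q\<^sup>2) * (c x)\<^sup>2) else 0))"
    by (intro sum.cong refl) (simp add: pair algebra_simps power2_eq_square)
  also have "\<dots> = 2 ^ (n * m) * (q\<^sup>2 * (\<Sum>x\<in>X. c x)\<^sup>2 + (q - q\<^sup>2) * (\<Sum>x\<in>X. (c x)\<^sup>2))"
    by (simp add: sum.distrib finX power2_eq_square[of "sum c X"] distrib_left
        flip: sum_distrib_left sum_distrib_right)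
  finally have second: "measure_pmf.expectation (random_linear_code n m) (\<lambda>H. (F H)\<^sup>2)
      = q\<^sup>2 * (\<Sum>x\<in>X. c x)\<^sup>2 + (q - q\<^sup>2) * (\<Sum>x\<in>X. (c x)\<^sup>2)"
    by (simp add: expectation_random_linear_code)
  have mean: "measure_pmf.expectation (random_linear_code n m) F = q * (\<Sum>x\<in>X. c x)"
    by (simp add: expectation_sum_codewords q_def)
  have "finite (set_pmf (random_linear_code n m))"
    unfolding random_linear_code_def using zero_carrier_mat[of m n]
    by (subst set_pmf_of_set) (auto simp: finite_carrier_bit_mat)
  then have "measure_pmf.variance (random_linear_code n m) F
      = measure_pmf.expectation (random_linear_code n m) (\<lambda>H. (F H)\<^sup>2)
        - (measure_pmf.expectation (random_linear_code n m) F)\<^sup>2"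
    by (intro measure_pmf.variance_eq integrable_measure_pmf_finite)
  also have "\<dots> = (\<Sum>x\<in>X. (c x)\<^sup>2) * q * (1 - q)"
    unfolding second mean by (simp add: power2_eq_square algebra_simps)
  finally show ?thesis unfolding q_def .
qed

end

section \<open>From the weight distribution to the exponential rate\<close>

text \<open>Group the nonzero vectors by weight. Starting at w = 1 leaves out exactly the zero
  vector, which satisfies every parity check.\<close>

lemma sum_weight_distribution:
  fixes f :: "nat \<Rightarrow> real"
  assumes "H \<in> carrier_mat m n"
  shows "(\<Sum>w=1..n. f w * real (weight_distribution w H))
    = (\<Sum>x\<in>carrier_vec n - {0\<^sub>v n}. f (hamming_weight x) * of_bool (H *\<^sub>v x = 0\<^sub>v m))"
proof -
  let ?X = "carrier_vec n - {0\<^sub>v n} :: bit vec set"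
  have wd: "real (weight_distribution w H)
      = (\<Sum>x | x \<in> ?X \<and> hamming_weight x = w. of_bool (H *\<^sub>v x = 0\<^sub>v m))" if "w \<in> {1..n}" for w
  proof -
    have "{x \<in> carrier_vec (dim_col H). hamming_weight x = w \<and> H *\<^sub>v x = 0\<^sub>v (dim_row H)}
      = {x. x \<in> ?X \<and> hamming_weight x = w} \<inter> {x. H *\<^sub>v x = 0\<^sub>v m}"
      using assms that hamming_weight_eq_0_iff[of _ n] by auto
    then show ?thesis
      unfolding weight_distribution_def by (simp add: finite_carrier_bit_vec)
  qed
  have "(\<Sum>w=1..n. f w * real (weight_distribution w H))
      = (\<Sum>w=1..n. \<Sum>x | x \<in> ?X \<and> hamming_weight x = w.
           f (hamming_weight x) * of_bool (H *\<^sub>v x = 0\<^sub>v m))"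
    by (intro sum.cong refl) (simp add: wd sum_distrib_left del: sum_of_bool_eq)
  also have "\<dots> = (\<Sum>x\<in>?X. f (hamming_weight x) * of_bool (H *\<^sub>v x = 0\<^sub>v m))"
    using hamming_weight_eq_0_iff[of _ n] hamming_weight_le[of _ n]
    by (intro sum.group) (auto simp: finite_carrier_bit_vec Suc_le_eq)
  finally show ?thesis .
qed

lemma sum_hamming_weight_nonzero:
  fixes a b :: real
  shows "(\<Sum>x\<in>carrier_vec n - {0\<^sub>v n}. a ^ hamming_weight x * b ^ (n - hamming_weight x))
    = (a + b) ^ n - b ^ n"
  by (simp add: sum_diff1 finite_carrier_bit_vec sum_hamming_weight)

theorem theorem3:
  fixes R K1 K2 :: real and \<Phi> :: "nat \<Rightarrow> nat \<Rightarrow> real"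
  assumes "0 < R" and "R < 1"
    and "K1 > 0" and "K2 > 0"
    and "\<And>n w. 1 \<le> w \<Longrightarrow> w \<le> n \<Longrightarrow> \<Phi> n w = K1 ^ w * K2 ^ (n - w)"
  shows "has_acr R (\<lambda>n H. \<Sum>w=1..n. \<Phi> n w * real (weight_distribution w H))
           (log 2 ((K1\<^sup>2 + K2\<^sup>2) / (K1 + K2)\<^sup>2) + 1 - R)"
proof -
  define F where "F = (\<lambda>n H. \<Sum>w=1..n. \<Phi> n w * real (weight_distribution w H))"
  define m where "m n = nat \<lfloor>(1 - R) * real n\<rfloor>" for n
  define V where "V n = measure_pmf.variance (random_linear_code n (m n)) (F n)" for n
  define E where "E n = measure_pmf.expectation (random_linear_code n (m n)) (F n)" for n
  define \<eta> where "\<eta> = log 2 ((K1\<^sup>2 + K2\<^sup>2) / (K1 + K2)\<^sup>2) + 1 - R"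
  \<comment> \<open>At admissible lengths \<open>p ^ n\<close> is 2^(-m). The powers
    \<open>q1 ^ n\<close> and \<open>q2 ^ n\<close> are the ratios of the subtracted to the leading
    terms in the mean and the variance; \<open>r\<close> below collects the logarithms of the
    resulting correction factors.\<close>
  define p where "p = 2 powr (R - 1)"
  define q1 where "q1 = K2 / (K1 + K2)"
  define q2 where "q2 = K2\<^sup>2 / (K1\<^sup>2 + K2\<^sup>2)"
  have p: "0 < p" "p < 1"
    using assms powr_less_mono[of "R - 1" 0 2] by (auto simp: p_def)
  have q1: "0 < q1" "q1 < 1" and q2: "0 < q2" "q2 < 1"
    using assms by (auto simp: q1_def q2_def add_pos_pos)
  define r where "r n = log 2 (1 - p ^ n) + log 2 (1 - q2 ^ n) - 2 * log 2 (1 - q1 ^ n)" for n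
  have F: "F n H = (\<Sum>x\<in>carrier_vec n - {0\<^sub>v n}.
      K1 ^ hamming_weight x * K2 ^ (n - hamming_weight x) * of_bool (H *\<^sub>v x = 0\<^sub>v k))"
    if "H \<in> carrier_mat k n" for n k H
  proof -
    have "F n H = (\<Sum>w=1..n. K1 ^ w * K2 ^ (n - w) * real (weight_distribution w H))"
      unfolding F_def using assms(5) by (intro sum.cong) auto
    also have "\<dots> = (\<Sum>x\<in>carrier_vec n - {0\<^sub>v n}.
        K1 ^ hamming_weight x * K2 ^ (n - hamming_weight x) * of_bool (H *\<^sub>v x = 0\<^sub>v k))"
      using that by (rule sum_weight_distribution)
    finally show ?thesis .
  qed
  have E: "E n = ((K1 + K2) ^ n - K2 ^ n) / 2 ^ m n" for n
    unfolding E_def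
    by (subst expectation_sum_codewords[OF subset_refl F]) (simp_all add: sum_hamming_weight_nonzero)
  have V: "V n = ((K1\<^sup>2 + K2\<^sup>2) ^ n - (K2\<^sup>2) ^ n) * (1 / 2 ^ m n) * (1 - 1 / 2 ^ m n)" for n
  proof -
    have "V n = (\<Sum>x\<in>carrier_vec n - {0\<^sub>v n}. (K1 ^ hamming_weight x * K2 ^ (n - hamming_weight x))\<^sup>2)
        * (1 / 2 ^ m n) * (1 - 1 / 2 ^ m n)"
      unfolding V_def by (rule variance_sum_codewords[OF subset_refl F])
    \<comment> \<open>Squared coefficients have the same shape with constants K1^2 and K2^2, so the
      binomial formula applies again.\<close>
    also have "(\<Sum>x\<in>carrier_vec n - {0\<^sub>v n}. (K1 ^ hamming_weight x * K2 ^ (n - hamming_weight x))\<^sup>2)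
        = (\<Sum>x\<in>carrier_vec n - {0\<^sub>v n}. (K1\<^sup>2) ^ hamming_weight x * (K2\<^sup>2) ^ (n - hamming_weight x))"
      by (simp add: power_mult_distrib mult.commute flip: power_mult)
    finally show ?thesis by (simp only: sum_hamming_weight_nonzero)
  qed
  have key: "1 / real n * log 2 (V n / (E n)\<^sup>2) = \<eta> + r n / real n"
    if n: "n > 0" and int: "(1 - R) * real n \<in> \<int>" for n
  proof -
    \<comment> \<open>Integrality makes the floor exact, and R < 1 keeps the value nonnegative, so
      \<open>nat\<close> does not truncate.\<close>
    have "real (m n) = (1 - R) * real n"
      using int assms unfolding m_def by (auto elim!: Ints_cases)
    then have two: "2 ^ m n = 2 powr ((1 - R) * real n)"
      by (metis powr_realpow zero_less_numeral)
    have pn: "p ^ n = 1 / 2 ^ m n"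
      unfolding two p_def by (simp add: powr_powr algebra_simps flip: powr_realpow powr_minus_divide)
    \<comment> \<open>Here n > 0 matters: it keeps the arguments of the logarithms in
      \<open>r\<close> positive.\<close>
    have lt: "p ^ n < 1" "q1 ^ n < 1" "q2 ^ n < 1"
      using p q1 q2 n by (auto simp: power_less_one_iff)
    have s: "K1 + K2 > 0" "K1\<^sup>2 + K2\<^sup>2 > 0"
      using assms by (auto simp: add_pos_pos)
    have E': "E n = (K1 + K2) ^ n * (1 - q1 ^ n) / 2 ^ m n"
      using s by (simp add: E q1_def power_divide field_simps)
    have V': "V n = (K1\<^sup>2 + K2\<^sup>2) ^ n * (1 - q2 ^ n) * (1 - p ^ n) / 2 ^ m n"
      using s by (simp add: V q2_def pn power_divide field_simps)
    have sq: "((K1 + K2)\<^sup>2) ^ n = ((K1 + K2) ^ n)\<^sup>2"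
      by (simp add: mult.commute flip: power_mult)
    \<comment> \<open>One factor 2^(-m) in the variance against two in the squared mean leaves 2^m,
      the source of the term 1 - R in the rate.\<close>
    have "V n / (E n)\<^sup>2
        = ((K1\<^sup>2 + K2\<^sup>2) / (K1 + K2)\<^sup>2) ^ n * 2 powr ((1 - R) * real n)
            * ((1 - p ^ n) * (1 - q2 ^ n) / (1 - q1 ^ n)\<^sup>2)"
      unfolding E' V' two[symmetric] power_divide sq
      by (simp add: power2_eq_square[of "2 ^ m n"] power_divide power_mult_distrib)
    also have "log 2 \<dots> = real n * \<eta> + r n"
    proof -
      have nz: "(K1\<^sup>2 + K2\<^sup>2) / (K1 + K2)\<^sup>2 > 0" "1 - p ^ n > 0" "1 - q1 ^ n > 0" "1 - q2 ^ n > 0"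
        using s lt by simp_all
      then have "log 2 (((K1\<^sup>2 + K2\<^sup>2) / (K1 + K2)\<^sup>2) ^ n)
          = real n * log 2 ((K1\<^sup>2 + K2\<^sup>2) / (K1 + K2)\<^sup>2)"
        and "log 2 ((1 - p ^ n) * (1 - q2 ^ n) / (1 - q1 ^ n)\<^sup>2) = r n"
        by (simp_all only: log_nat_power log_mult_pos log_divide_pos mult_pos_pos zero_less_power r_def
            of_nat_numeral)
      then show ?thesis
        using nz by (subst log_mult_pos, simp, simp)+ (simp add: \<eta>_def algebra_simps)
    qed
    finally show ?thesis using n by (simp add: field_simps)
  qed
  \<comment> \<open>The bases \<open>p\<close>, \<open>q1\<close>, \<open>q2\<close> lie strictly
    between 0 and 1, so every correction factor tends to 1.\<close>
  have "(\<lambda>n. \<eta> + r n * (1 / real n)) \<longlonglongrightarrow> \<eta> + (log 2 (1 - 0) + log 2 (1 - 0) - 2 * log 2 (1 - 0)) * 0"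
    unfolding r_def using p q1 q2
    by (intro tendsto_intros LIMSEQ_realpow_zero lim_1_over_n) auto
  then have lim: "(\<lambda>n. \<eta> + r n / real n) \<longlonglongrightarrow> \<eta>"
    by simp
  have "\<forall>\<^sub>F n in design_lengths R. \<eta> + r n / real n = 1 / real n * log 2 (V n / (E n)\<^sup>2)"
    unfolding design_lengths_def eventually_inf_principal
    using eventually_gt_at_top[of 0] by eventually_elim (metis key mem_Collect_eq)
  \<comment> \<open>The closed form converges along all n, hence along the finer filter of
    admissible lengths, where it eventually agrees with the quantity in question.\<close>
  moreover have "((\<lambda>n. \<eta> + r n / real n) \<longlongrightarrow> \<eta>) (design_lengths R)"
    using lim unfolding design_lengths_def by (rule tendsto_mono[rotated]) simp
  ultimately have "((\<lambda>n. 1 / real n * log 2 (V n / (E n)\<^sup>2)) \<longlongrightarrow> \<eta>) (design_lengths R)"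
    by (rule Lim_transform_eventually[rotated])
  then show ?thesis
    unfolding has_acr_def Let_def V_def E_def \<eta>_def F_def m_def .
qed

end
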